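(* The union of the sets of $r$-graph Turán densities over all integers $r\ge 2$ is dense in $[0,1]$; that is, the topological closure of $\bigcup_{r=2}^\infty \Pi_\infty^{(r)}$ equals $[0,1]$.
   Context: Let $r\ge 2$ be an integer. An $r$-graph is an $r$-uniform set system, i.e. a finite vertex set together with a collection of $r$-element subsets of it (edges). Let $\mathcal F$ be a (possibly infinite, possibly empty) family of $r$-graphs, each having at least one edge. An $r$-graph $G$ is $\mathcal F$-free if no member $F\in\mathcal F$ is a subgraph of $G$, i.e. no $F\in\mathcal F$ can be obtained (up to isomorphism) by deleting some vertices and edges from $G$ (subgraphs are not required to be induced). The Turán function $\mathrm{ex}(n,\mathcal F)$ is the maximum number of edges in an $\mathcal F$-free $r$-graph on $n$ vertices. The Turán density of $\mathcal F$ is $\pi(\mathcal F):=\lim_{n\to\infty}\mathrm{ex}(n,\mathcal F)/\binom{n}{r}$ (the limit is known to exist). $\Pi_\infty^{(r)}\subseteq[0,1]$ denotes the set of all values $\pi(\mathcal F)$ over all such families $\mathcal F$ of $r$-graphs (finite or infinite; the empty family is allowed, so $1\in\Pi_\infty^{(r)}$). *)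

theory Defs
  imports "HOL-Analysis.Analysis" "HOL-Library.Ramsey"
begin

record 'a hypergraph =
  verts :: "'a set"
  edges :: "'a set set"

definition uniform_hypergraph :: "nat \<Rightarrow> 'a hypergraph \<Rightarrow> bool" where
  "uniform_hypergraph r G \<longleftrightarrow> finite (verts G) \<and> edges G \<subseteq> nsets (verts G) r"

definition subgraph_of :: "'a hypergraph \<Rightarrow> 'a hypergraph \<Rightarrow> bool" where
  "subgraph_of H G \<longleftrightarrow> verts H \<subseteq> verts G \<and> edges H \<subseteq> edges G"

definition isomorphic :: "'a hypergraph \<Rightarrow> 'b hypergraph \<Rightarrow> bool" where
  "isomorphic F H \<longleftrightarrow>
     (\<exists>f. bij_betw f (verts F) (verts H) \<and> edges H = (\<lambda>e. f ` e) ` edges F)"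

definition hfree :: "'a hypergraph set \<Rightarrow> 'b hypergraph \<Rightarrow> bool" where
  "hfree \<F> G \<longleftrightarrow> \<not> (\<exists>F\<in>\<F>. \<exists>H. subgraph_of H G \<and> isomorphic F H)"

text \<open>
  Every finite hypergraph is isomorphic to one whose vertices are natural numbers, so from here on
  all vertex sets are taken inside \<^typ>\<open>nat\<close>; this loses neither families nor host graphs.
\<close>

definition forbidden_family :: "nat \<Rightarrow> nat hypergraph set \<Rightarrow> bool" where
  "forbidden_family r \<F> \<longleftrightarrow> (\<forall>F\<in>\<F>. uniform_hypergraph r F \<and> edges F \<noteq> {})"

text \<open>
  For a forbidden family the set below is nonempty (the edgeless graph is free, as every member
  has an edge) and bounded by \<^term>\<open>n choose r\<close>, so the maximum is a genuine one.
\<close>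

definition turan_ex :: "nat \<Rightarrow> nat \<Rightarrow> nat hypergraph set \<Rightarrow> nat" where
  "turan_ex r n \<F> =
     Max {card (edges G) | G :: nat hypergraph.
            uniform_hypergraph r G \<and> card (verts G) = n \<and> hfree \<F> G}"

definition turan_density :: "nat \<Rightarrow> nat hypergraph set \<Rightarrow> real" where
  "turan_density r \<F> = lim (\<lambda>n. real (turan_ex r n \<F>) / real (n choose r))"

definition turan_densities :: "nat \<Rightarrow> real set" where
  "turan_densities r = {turan_density r \<F> | \<F>. forbidden_family r \<F>}"

end

theory Submission
  imports Defs
begin

text \<open>
  Given a set \<^term>\<open>E\<close> of \<^term>\<open>r\<close>-element sets, forbid all \<^term>\<open>r\<close>-graphs that are not
  contained in a blow-up of \<^term>\<open>E\<close>; the free graphs are then exactly the subgraphs of blow-ups.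
  Adding one set to \<^term>\<open>E\<close> adds at most the edges of a complete \<^term>\<open>r\<close>-partite
  \<^term>\<open>r\<close>-graph, so by AM-GM the Turan density grows by at most \<open>r! / r^r \<le> 1 / r\<close>.
  The density is \<open>0\<close> for empty \<^term>\<open>E\<close> and tends to \<open>1\<close> for the complete \<^term>\<open>r\<close>-graphs on
  more and more vertices. Building up a large complete \<^term>\<open>r\<close>-graph edge by edge therefore
  produces densities within \<open>1 / r\<close> of any prescribed number in \<open>[0, 1)\<close>.
\<close>

section \<open>Turan numbers\<close>

lemma hfree_mono:
  assumes "hfree \<F> G" "subgraph_of H G"
  shows "hfree \<F> H"
  using assms unfolding hfree_def subgraph_of_def by blast

lemma card_edges_le:
  assumes "uniform_hypergraph r G"
  shows "card (edges G) \<le> card (verts G) choose r"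
  using assms unfolding uniform_hypergraph_def
  by (metis card_mono card_nsets finite_imp_finite_nsets)

lemma finite_edges:
  assumes "uniform_hypergraph r G"
  shows "finite (edges G)"
  using assms unfolding uniform_hypergraph_def
  by (metis finite_imp_finite_nsets finite_subset)

lemma finite_turan_set:
  "finite {card (edges G) | G :: nat hypergraph.
      uniform_hypergraph r G \<and> card (verts G) = n \<and> hfree \<F> G}"
  by (rule finite_subset[of _ "{..n choose r}"]) (auto dest: card_edges_le)

lemma card_edges_le_turan_ex:
  fixes G :: "nat hypergraph"
  assumes "uniform_hypergraph r G" "card (verts G) = n" "hfree \<F> G"
  shows "card (edges G) \<le> turan_ex r n \<F>"
  unfolding turan_ex_def using assms by (intro Max_ge finite_turan_set) blast

text \<open>An isomorphism carries edges to edges, so a copy of a forbidden graph has at least one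
  edge. Hence the maximum in \<open>turan_ex\<close> is over a nonempty set.\<close>

lemma hfree_edgeless:
  assumes "forbidden_family r \<F>" "edges G = {}"
  shows "hfree \<F> G"
  using assms unfolding hfree_def forbidden_family_def subgraph_of_def isomorphic_def by fastforce

lemma turan_ex_attained:
  assumes "forbidden_family r \<F>"
  obtains G :: "nat hypergraph" where "uniform_hypergraph r G" "card (verts G) = n" "hfree \<F> G"
    "card (edges G) = turan_ex r n \<F>"
proof -
  let ?S = "{card (edges G) | G :: nat hypergraph.
      uniform_hypergraph r G \<and> card (verts G) = n \<and> hfree \<F> G}"
  let ?G = "\<lparr>verts = {..<n}, edges = {}\<rparr>"
  have "uniform_hypergraph r ?G" "card (verts ?G) = n" "hfree \<F> ?G"
    using hfree_edgeless[OF assms, of ?G] by (auto simp: uniform_hypergraph_def)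
  then have "?S \<noteq> {}"
    by blast
  then have "Max ?S \<in> ?S"
    by (rule Max_in[OF finite_turan_set])
  then show ?thesis
    using that unfolding turan_ex_def by force
qed

lemma turan_ex_le:
  assumes "forbidden_family r \<F>"
  shows "turan_ex r n \<F> \<le> n choose r"
  by (metis turan_ex_attained[OF assms] card_edges_le)

text \<open>Averaging: each edge of an extremal graph survives the deletion of
  \<^term>\<open>Suc n - r\<close> of its \<^term>\<open>Suc n\<close> vertices.\<close>

lemma turan_ex_Suc:
  assumes "forbidden_family r \<F>"
  shows "(Suc n - r) * turan_ex r (Suc n) \<F> \<le> Suc n * turan_ex r n \<F>"
proof -
  obtain G :: "nat hypergraph" where G: "uniform_hypergraph r G" "card (verts G) = Suc n" "hfree \<F> G"
    "card (edges G) = turan_ex r (Suc n) \<F>"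
    by (rule turan_ex_attained[OF assms])
  have fin: "finite (verts G)" and sub: "edges G \<subseteq> nsets (verts G) r"
    using G(1) by (auto simp: uniform_hypergraph_def)
  have "(Suc n - r) * turan_ex r (Suc n) \<F> = (\<Sum>e\<in>edges G. card {v \<in> verts G. v \<notin> e})"
  proof -
    have "card {v \<in> verts G. v \<notin> e} = Suc n - r" if "e \<in> edges G" for e
    proof -
      have "e \<subseteq> verts G" "card e = r" "finite e"
        using that sub by (auto simp: nsets_def)
      moreover have "{v \<in> verts G. v \<notin> e} = verts G - e" by auto
      ultimately show ?thesis using G(2) by (simp add: card_Diff_subset)
    qed
    then show ?thesis using G(4) by simp
  qed
  \<comment> \<open>Double counting of the pairs of an edge and a vertex outside it.\<close>
  also have "\<dots> = (\<Sum>v\<in>verts G. card {e \<in> edges G. v \<notin> e})"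
    by (rule sum_multicount_gen[OF finite_edges[OF G(1)] fin]) simp
  also have "\<dots> \<le> (\<Sum>v\<in>verts G. turan_ex r n \<F>)"
  proof (rule sum_mono)
    fix v assume v: "v \<in> verts G"
    let ?H = "\<lparr>verts = verts G - {v}, edges = {e \<in> edges G. v \<notin> e}\<rparr>"
    have "uniform_hypergraph r ?H"
      using fin sub by (auto simp: uniform_hypergraph_def nsets_def)
    moreover have "card (verts ?H) = n"
      using v G(2) fin by simp
    moreover have "hfree \<F> ?H"
      by (rule hfree_mono[OF G(3)]) (auto simp: subgraph_of_def)
    ultimately show "card {e \<in> edges G. v \<notin> e} \<le> turan_ex r n \<F>"
      using card_edges_le_turan_ex by fastforce
  qed
  finally show ?thesis using G(2) by simp
qed

section \<open>Convergence of the Turan ratios\<close>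

lemma turan_ratio_Suc:
  assumes "forbidden_family r \<F>" "r \<le> n"
  shows "real (turan_ex r (Suc n) \<F>) / real (Suc n choose r)
       \<le> real (turan_ex r n \<F>) / real (n choose r)"
proof -
  have pos: "0 < real (n choose r)" "0 < real (Suc n choose r)" "0 < real (Suc n)"
    using assms(2) by simp_all
  \<comment> \<open>The binomials satisfy with equality the recursion that
    \<open>turan_ex_Suc\<close> gives as an inequality; dividing one by the other yields the
    claim.\<close>
  have "(Suc n - r) * (Suc n choose r) = Suc n * (n choose r)"
    using binomial_absorb_comp[of "Suc n" r] by simp
  then have binom: "real (Suc n - r) * real (Suc n choose r) = real (Suc n) * real (n choose r)"
    by (metis of_nat_mult)
  have ex: "real (Suc n - r) * real (turan_ex r (Suc n) \<F>) \<le> real (Suc n) * real (turan_ex r n \<F>)"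
    using turan_ex_Suc[OF assms(1), of n] by (metis of_nat_le_iff of_nat_mult)
  have "real (Suc n) * (real (turan_ex r (Suc n) \<F>) * real (n choose r))
      = (real (Suc n - r) * real (turan_ex r (Suc n) \<F>)) * real (Suc n choose r)"
    using binom by algebra
  also have "\<dots> \<le> real (Suc n) * real (turan_ex r n \<F>) * real (Suc n choose r)"
    by (intro mult_right_mono ex) simp
  finally have "real (turan_ex r (Suc n) \<F>) * real (n choose r)
      \<le> real (turan_ex r n \<F>) * real (Suc n choose r)"
    using pos(3) by (simp add: mult.assoc del: of_nat_Suc)
  then show ?thesis
    using pos by (simp add: divide_simps mult.commute)
qed

lemma tendsto_turan_density:
  assumes "forbidden_family r \<F>"
  shows "(\<lambda>n. real (turan_ex r n \<F>) / real (n choose r)) \<longlonglongrightarrow> turan_density r \<F>"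
proof -
  let ?f = "\<lambda>n. real (turan_ex r n \<F>) / real (n choose r)"
  \<comment> \<open>The shift by \<open>r\<close> skips the indices with a zero denominator, where
    the ratio is 0 by convention and monotonicity may fail.\<close>
  have "decseq (\<lambda>n. ?f (n + r))"
    using turan_ratio_Suc[OF assms] by (intro decseq_SucI) (simp del: binomial_Suc_Suc)
  then obtain L where "(\<lambda>n. ?f (n + r)) \<longlonglongrightarrow> L"
    using decseq_convergent[of "\<lambda>n. ?f (n + r)" 0] by auto
  then have "?f \<longlonglongrightarrow> L"
    by (rule LIMSEQ_offset)
  then show ?thesis
    unfolding turan_density_def using limI by blast
qed

lemma turan_density_in_unit:
  assumes "forbidden_family r \<F>"
  shows "turan_density r \<F> \<in> {0..1}"
proof -
  have "real (turan_ex r n \<F>) / real (n choose r) \<le> 1" for n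
    using turan_ex_le[OF assms, of n] by (auto simp: divide_simps)
  then show ?thesis
    using LIMSEQ_le_const[OF tendsto_turan_density[OF assms], of 0]
      LIMSEQ_le_const2[OF tendsto_turan_density[OF assms], of 1] by auto
qed

section \<open>Families of non-colourable hypergraphs\<close>

text \<open>For \<^term>\<open>E\<close> consisting of sets of size \<^term>\<open>r\<close>, an \<^term>\<open>r\<close>-graph is colourable by
  \<^term>\<open>E\<close> iff it is a subgraph of a blow-up of \<^term>\<open>E\<close>.\<close>

definition colourable :: "nat set set \<Rightarrow> 'a hypergraph \<Rightarrow> bool" where
  "colourable E G \<longleftrightarrow> (\<exists>h. \<forall>e\<in>edges G. h ` e \<in> E)"

definition noncolourable :: "nat \<Rightarrow> nat set set \<Rightarrow> nat hypergraph set" where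
  "noncolourable r E = {F. uniform_hypergraph r F \<and> edges F \<noteq> {} \<and> \<not> colourable E F}"

lemma forbidden_family_noncolourable: "forbidden_family r (noncolourable r E)"
  by (simp add: forbidden_family_def noncolourable_def)

text \<open>Colourings pull back along copies, so a colourable graph contains no member of the
  family; a non-colourable one is itself a member.\<close>

lemma hfree_noncolourable_iff:
  fixes G :: "nat hypergraph"
  assumes "uniform_hypergraph r G"
  shows "hfree (noncolourable r E) G \<longleftrightarrow> colourable E G"
proof
  assume free: "hfree (noncolourable r E) G"
  show "colourable E G"
  proof (rule ccontr)
    assume non: "\<not> colourable E G"
    then have "edges G \<noteq> {}"
      by (auto simp: colourable_def)
    with non assms have "G \<in> noncolourable r E"
      by (simp add: noncolourable_def)
    moreover have "isomorphic G G"
      unfolding isomorphic_def by (rule exI[of _ id]) simp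
    moreover have "subgraph_of G G"
      by (simp add: subgraph_of_def)
    ultimately show False
      using free unfolding hfree_def by blast
  qed
next
  assume "colourable E G"
  then obtain h where h: "\<And>e. e \<in> edges G \<Longrightarrow> h ` e \<in> E"
    by (auto simp: colourable_def)
  have "colourable E F" if sub: "subgraph_of H G" and iso: "isomorphic F H" for F :: "nat hypergraph" and H
  proof -
    obtain f where f: "edges H = (\<lambda>e. f ` e) ` edges F"
      using iso by (auto simp: isomorphic_def)
    have "(h \<circ> f) ` e \<in> E" if "e \<in> edges F" for e
    proof -
      have "f ` e \<in> edges G"
        using f that sub by (auto simp: subgraph_of_def)
      from h[OF this] show ?thesis
        by (simp add: image_comp)
    qed
    then show ?thesis
      unfolding colourable_def by blast
  qed
  then show "hfree (noncolourable r E) G"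
    by (auto simp: hfree_def noncolourable_def)
qed

text \<open>A set with as many elements as \<open>A\<close> and image \<open>A\<close> picks exactly
  one vertex from each fibre, so these sets correspond to the choice functions in
  \<open>PiE\<close>.\<close>

lemma card_transversals:
  assumes "finite V" "finite A"
  shows "card {e \<in> nsets V (card A). h ` e = A} = (\<Prod>a\<in>A. card {v \<in> V. h v = a})"
proof -
  let ?P = "PiE A (\<lambda>a. {v \<in> V. h v = a})"
  have "bij_betw (\<lambda>g. g ` A) ?P {e \<in> nsets V (card A). h ` e = A}"
  proof (rule bij_betwI')
    fix g g' assume g: "g \<in> ?P" and g': "g' \<in> ?P"
    show "(g ` A = g' ` A) = (g = g')"
    proof
      assume eq: "g ` A = g' ` A"
      show "g = g'"
      proof (rule PiE_ext[OF g g'])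
        fix a assume a: "a \<in> A"
        then obtain b where b: "b \<in> A" "g a = g' b"
          using eq by (metis imageE imageI)
        have "h (g a) = a" "h (g' b) = b"
          using PiE_mem[OF g a] PiE_mem[OF g' b(1)] by auto
        then have "a = b"
          using b by simp
        then show "g a = g' a" using b by simp
      qed
    qed simp
  next
    fix g assume g: "g \<in> ?P"
    then have hg: "h (g a) = a" "g a \<in> V" if "a \<in> A" for a
      using that by (auto dest: PiE_mem)
    then have "inj_on g A"
      by (metis inj_onI)
    then show "g ` A \<in> {e \<in> nsets V (card A). h ` e = A}"
      using hg assms by (auto simp: nsets_def card_image image_image)
  next
    fix e assume "e \<in> {e \<in> nsets V (card A). h ` e = A}"
    then have e: "e \<subseteq> V" "finite e" "card e = card A" and he: "h ` e = A"
      by (auto simp: nsets_def)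
    then have inj: "inj_on h e"
      by (auto intro: eq_card_imp_inj_on)
    let ?g = "restrict (inv_into e h) A"
    have "?g \<in> ?P"
      using he e(1) by (auto simp: f_inv_into_f intro!: subsetD[OF e(1)] inv_into_into)
    moreover have "?g ` A = e"
      using he inj by auto
    ultimately show "\<exists>g\<in>?P. e = g ` A"
      by blast
  qed
  then show ?thesis
    using assms by (simp add: bij_betw_same_card[symmetric] card_PiE)
qed

text \<open>AM-GM, from \<^prop>\<open>x \<le> exp (x - 1)\<close> applied to the summands divided by their mean.\<close>

lemma prod_le_mean_power:
  fixes x :: "'a \<Rightarrow> real"
  assumes "finite A" "A \<noteq> {}" "\<And>a. a \<in> A \<Longrightarrow> 0 \<le> x a" "sum x A \<le> s" "0 < s"
  shows "prod x A \<le> (s / card A) ^ card A"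
proof -
  \<comment> \<open>As \<open>s\<close> only bounds the sum, \<mu> bounds the mean from above; it
    stays positive even if all summands vanish.\<close>
  define \<mu> where "\<mu> = s / card A"
  have c: "0 < real (card A)"
    using assms(1,2) by (simp add: card_gt_0_iff)
  then have \<mu>: "0 < \<mu>"
    using assms(5) by (simp add: \<mu>_def)
  have "prod x A = (\<Prod>a\<in>A. \<mu> * (x a / \<mu>))"
    using \<mu> by simp
  also have "\<dots> = \<mu> ^ card A * (\<Prod>a\<in>A. x a / \<mu>)"
    by (simp only: prod.distrib prod_constant)
  also have "(\<Prod>a\<in>A. x a / \<mu>) \<le> (\<Prod>a\<in>A. exp (x a / \<mu> - 1))"
  proof (rule prod_mono)
    fix a assume "a \<in> A"
    then show "0 \<le> x a / \<mu> \<and> x a / \<mu> \<le> exp (x a / \<mu> - 1)"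
      using assms(3) \<mu> exp_ge_add_one_self[of "x a / \<mu> - 1"] by simp
  qed
  also have "\<dots> = exp (sum x A / \<mu> - card A)"
    using assms(1) by (simp add: exp_sum[symmetric] sum_subtractf sum_divide_distrib)
  also have "\<dots> \<le> 1"
  proof -
    have "sum x A / \<mu> \<le> s / \<mu>"
      using assms(4) \<mu> by (simp add: divide_right_mono)
    also have "s / \<mu> = card A"
      using assms(5) c by (simp add: \<mu>_def)
    finally show ?thesis by simp
  qed
  finally show ?thesis
    using \<mu> by (simp add: \<mu>_def mult_left_mono)
qed

text \<open>The fibres over \<open>A\<close> are disjoint subsets of \<open>V\<close>, so their
  sizes add up to at most \<open>card V\<close> and AM-GM applies.\<close>

lemma card_transversals_le:
  assumes "finite V" "V \<noteq> {}" "finite A" "A \<noteq> {}"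
  shows "real (card {e \<in> nsets V (card A). h ` e = A}) \<le> (card V / card A) ^ card A"
proof -
  have "(\<Sum>a\<in>A. card {v \<in> V. h v = a}) = card (\<Union>a\<in>A. {v \<in> V. h v = a})"
    using assms by (subst card_UN_disjoint) auto
  also have "\<dots> \<le> card V"
    using assms by (intro card_mono) auto
  finally have "(\<Sum>a\<in>A. real (card {v \<in> V. h v = a})) \<le> real (card V)"
    by (metis of_nat_le_iff of_nat_sum)
  then have "(\<Prod>a\<in>A. real (card {v \<in> V. h v = a})) \<le> (card V / card A) ^ card A"
    using assms by (intro prod_le_mean_power) (auto simp: card_gt_0_iff)
  then show ?thesis
    using assms by (simp add: card_transversals)
qed

section \<open>Densities of the families of non-colourable hypergraphs\<close>

lemma tendsto_binomial_over_power:
  "(\<lambda>n. real (n choose r) * fact r / real n ^ r) \<longlonglongrightarrow> 1"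
proof -
  have "eventually (\<lambda>n. (\<Prod>i=0..<r. 1 - real i / real n) = real (n choose r) * fact r / real n ^ r)
      sequentially"
    using eventually_gt_at_top[of 0]
  proof eventually_elim
    case (elim n)
    have "real (n choose r) * fact r / real n ^ r = (\<Prod>i=0..<r. real n - real i) / real n ^ r"
      by (simp add: binomial_gbinomial gbinomial_prod_rev)
    also have "\<dots> = (\<Prod>i=0..<r. (real n - real i) / real n)"
      by (simp add: prod_dividef)
    also have "\<dots> = (\<Prod>i=0..<r. 1 - real i / real n)"
      using elim by (simp add: diff_divide_distrib)
    finally show ?case by simp
  qed
  moreover have "(\<lambda>n. \<Prod>i=0..<r. 1 - real i / real n) \<longlonglongrightarrow> (\<Prod>i=0..<r. 1 - 0)"
    by (intro tendsto_intros lim_const_over_n)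
  ultimately show ?thesis
    by (simp add: tendsto_cong)
qed

text \<open>One factor of \<open>r!\<close> is 1 and the others are at most
  \<open>r\<close>.\<close>

lemma fact_over_power_le:
  assumes "0 < r"
  shows "fact r / real r ^ r \<le> 1 / real r"
proof -
  obtain k where r: "r = Suc k"
    using assms gr0_conv_Suc by blast
  have "fact (Suc k) \<le> real (Suc k) ^ k"
  proof (induction k)
    case (Suc k)
    have "fact (Suc (Suc k)) = real (Suc (Suc k)) * fact (Suc k)"
      by (rule fact_Suc)
    also have "\<dots> \<le> real (Suc (Suc k)) * real (Suc (Suc k)) ^ k"
      by (intro mult_left_mono order_trans[OF Suc] power_mono) simp_all
    finally show ?case by simp
  qed simp
  then show ?thesis
    unfolding r by (simp add: divide_simps mult_ac del: of_nat_Suc fact_Suc)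
qed

lemma turan_density_empty: "turan_density r (noncolourable r {}) = 0"
proof -
  have "turan_ex r n (noncolourable r {}) = 0" for n
  proof -
    obtain G :: "nat hypergraph" where G: "uniform_hypergraph r G" "hfree (noncolourable r {}) G"
      "card (edges G) = turan_ex r n (noncolourable r {})"
      using turan_ex_attained[OF forbidden_family_noncolourable] by metis
    then have "edges G = {}"
      by (auto simp: hfree_noncolourable_iff colourable_def)
    then show ?thesis using G(3) by simp
  qed
  then show ?thesis
    using tendsto_turan_density[OF forbidden_family_noncolourable, of r "{}"]
    by (simp add: LIMSEQ_const_iff)
qed

text \<open>Deleting the edges mapped onto \<open>A\<close> from an extremal graph leaves a graph
  colourable by \<open>E\<close>; the deleted edges are transversals of the fibres over
  \<open>A\<close>.\<close>

lemma turan_ex_insert: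
  assumes "card A = r" "0 < r" "0 < n"
  shows "real (turan_ex r n (noncolourable r (insert A E)))
      \<le> real (turan_ex r n (noncolourable r E)) + (n / r) ^ r"
proof -
  obtain G :: "nat hypergraph" where G: "uniform_hypergraph r G" "card (verts G) = n"
      "hfree (noncolourable r (insert A E)) G"
      "card (edges G) = turan_ex r n (noncolourable r (insert A E))"
    by (rule turan_ex_attained[OF forbidden_family_noncolourable])
  have fin: "finite (verts G)" and sub: "edges G \<subseteq> nsets (verts G) r"
    using G(1) by (auto simp: uniform_hypergraph_def)
  obtain h where h: "\<And>e. e \<in> edges G \<Longrightarrow> h ` e \<in> insert A E"
    using G(1,3) by (auto simp: hfree_noncolourable_iff colourable_def)
  have A: "finite A" "A \<noteq> {}"
    using assms(1,2) by (auto intro: card_ge_0_finite)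
  let ?T = "{e \<in> nsets (verts G) r. h ` e = A}"
  let ?H = "\<lparr>verts = verts G, edges = {e \<in> edges G. h ` e \<noteq> A}\<rparr>"
  have H: "uniform_hypergraph r ?H"
    using G(1) by (auto simp: uniform_hypergraph_def)
  have "colourable E ?H"
    unfolding colourable_def using h by (intro exI[of _ h]) auto
  then have "card (edges ?H) \<le> turan_ex r n (noncolourable r E)"
    using H G(2) by (intro card_edges_le_turan_ex) (auto simp: hfree_noncolourable_iff)
  moreover have "real (card ?T) \<le> (n / r) ^ r"
    using card_transversals_le[OF fin _ A, of h] assms G(2) by force
  moreover have "card (edges G) \<le> card (edges ?H) + card ?T"
  proof -
    have "card (edges G) \<le> card (edges ?H \<union> ?T)"
      using sub finite_edges[OF H] finite_imp_finite_nsets[OF fin, of r]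
      by (intro card_mono) auto
    then show ?thesis
      using card_Un_le order_trans by blast
  qed
  ultimately show ?thesis
    using G(4) by linarith
qed

lemma turan_density_insert:
  assumes "card A = r" "0 < r"
  shows "turan_density r (noncolourable r (insert A E))
      \<le> turan_density r (noncolourable r E) + 1 / r"
proof -
  \<comment> \<open>The gain \<open>(n / r) ^ r\<close> divided by \<open>n choose r\<close> is
    \<open>?q n * (fact r / r ^ r)\<close>, where \<open>?q\<close> tends to 1.\<close>
  let ?q = "\<lambda>n. real n ^ r / (real (n choose r) * fact r)"
  have "(\<lambda>n. inverse (real (n choose r) * fact r / real n ^ r)) \<longlonglongrightarrow> inverse 1"
    by (intro tendsto_inverse tendsto_binomial_over_power) simp
  then have "?q \<longlonglongrightarrow> 1"
    by simp
  then have "(\<lambda>n. real (turan_ex r n (noncolourable r E)) / real (n choose r)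
        + ?q n * (fact r / real r ^ r))
      \<longlonglongrightarrow> turan_density r (noncolourable r E) + 1 * (fact r / real r ^ r)"
    by (intro tendsto_intros tendsto_turan_density forbidden_family_noncolourable)
  moreover have "eventually (\<lambda>n. real (turan_ex r n (noncolourable r (insert A E))) / real (n choose r)
      \<le> real (turan_ex r n (noncolourable r E)) / real (n choose r)
        + ?q n * (fact r / real r ^ r)) sequentially"
    using eventually_gt_at_top[of 0]
  proof eventually_elim
    case (elim n)
    have "real (turan_ex r n (noncolourable r (insert A E))) / real (n choose r)
        \<le> (real (turan_ex r n (noncolourable r E)) + (n / r) ^ r) / real (n choose r)"
      by (intro divide_right_mono turan_ex_insert assms elim) simp
    also have "\<dots> = real (turan_ex r n (noncolourable r E)) / real (n choose r)
        + ?q n * (fact r / real r ^ r)"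
      by (simp add: add_divide_distrib power_divide)
    finally show ?case .
  qed
  ultimately have "turan_density r (noncolourable r (insert A E))
      \<le> turan_density r (noncolourable r E) + 1 * (fact r / real r ^ r)"
    by (intro tendsto_le[OF _ _ tendsto_turan_density[OF forbidden_family_noncolourable]]) auto
  then show ?thesis
    using fact_over_power_le[OF assms(2)] by simp
qed

section \<open>Lower bounds from balanced blow-ups of complete graphs\<close>

lemma turan_ex_complete_ge:
  assumes "0 < l"
  shows "(l choose r) * m ^ r \<le> turan_ex r (m * l) (noncolourable r (nsets {..<l} r))"
proof -
  let ?V = "{..<m * l}"
  \<comment> \<open>Residues split the \<open>m * l\<close> vertices evenly into \<open>l\<close>
    colour classes, so each \<open>r\<close>-set of colours has at least \<open>m ^ r\<close>
    transversals.\<close>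
  define h where "h = (\<lambda>v::nat. v mod l)"
  let ?T = "\<lambda>A. {e \<in> nsets ?V r. h ` e = A}"
  let ?G = "\<lparr>verts = ?V, edges = {e \<in> nsets ?V r. h ` e \<in> nsets {..<l} r}\<rparr>"
  have G: "uniform_hypergraph r ?G"
    by (auto simp: uniform_hypergraph_def)
  have fibre: "m \<le> card {v \<in> ?V. h v = a}" if "a < l" for a
  proof -
    have "j * l + a < m * l" if "j < m" for j
    proof -
      have "j * l + a < Suc j * l"
        using \<open>a < l\<close> by simp
      also have "\<dots> \<le> m * l"
        using that by (intro mult_le_mono1) simp
      finally show ?thesis .
    qed
    then have "(\<lambda>j. j * l + a) ` {..<m} \<subseteq> {v \<in> ?V. h v = a}"
      using that by (auto simp: h_def)
    moreover have "inj_on (\<lambda>j. j * l + a) {..<m}"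
      using assms by (auto simp: inj_on_def)
    ultimately have "card {..<m} \<le> card {v \<in> ?V. h v = a}"
      by (intro card_inj_on_le[where f = "\<lambda>j. j * l + a"]) simp_all
    then show ?thesis by simp
  qed
  have T: "m ^ r \<le> card (?T A)" if "A \<in> nsets {..<l} r" for A
  proof -
    have A: "A \<subseteq> {..<l}" "finite A" "card A = r"
      using that by (auto simp: nsets_def)
    have "m ^ r = (\<Prod>a\<in>A. m)"
      using A by simp
    also have "\<dots> \<le> (\<Prod>a\<in>A. card {v \<in> ?V. h v = a})"
      using A(1) fibre by (intro prod_mono) auto
    also have "\<dots> = card (?T A)"
      using card_transversals[of ?V A h] A by simp
    finally show ?thesis .
  qed
  have "(l choose r) * m ^ r = (\<Sum>A\<in>nsets {..<l} r. m ^ r)"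
    by simp
  also have "\<dots> \<le> (\<Sum>A\<in>nsets {..<l} r. card (?T A))"
    by (intro sum_mono T)
  \<comment> \<open>An edge determines its set of colours, so the families \<open>?T A\<close> are
    disjoint.\<close>
  also have "\<dots> = card (\<Union>A\<in>nsets {..<l} r. ?T A)"
    by (subst card_UN_disjoint) (auto simp: finite_imp_finite_nsets)
  also have "(\<Union>A\<in>nsets {..<l} r. ?T A) = edges ?G"
    by auto
  also have "card (edges ?G) \<le> turan_ex r (m * l) (noncolourable r (nsets {..<l} r))"
  proof (rule card_edges_le_turan_ex[OF G])
    have "colourable (nsets {..<l} r) ?G"
      unfolding colourable_def by (intro exI[of _ h]) simp
    then show "hfree (noncolourable r (nsets {..<l} r)) ?G"
      by (simp only: hfree_noncolourable_iff[OF G])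
  qed simp
  finally show ?thesis .
qed

text \<open>As the limit exists, the multiples of \<open>l\<close> suffice to bound it; there the
  blow-up bound and \<open>binomial_fact_pow\<close> give an estimate independent of
  \<open>m\<close>.\<close>

lemma turan_density_complete_ge:
  assumes "0 < l" "r \<le> l"
  shows "real (l choose r) * fact r / real l ^ r \<le> turan_density r (noncolourable r (nsets {..<l} r))"
proof -
  let ?F = "noncolourable r (nsets {..<l} r)"
  let ?f = "\<lambda>n. real (turan_ex r n ?F) / real (n choose r)"
  have "strict_mono (\<lambda>m. m * l)"
    using assms(1) by (simp add: strict_mono_def)
  from LIMSEQ_subseq_LIMSEQ[OF tendsto_turan_density[OF forbidden_family_noncolourable] this]
  have lim: "(\<lambda>m. ?f (m * l)) \<longlonglongrightarrow> turan_density r ?F"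
    by (simp add: o_def)
  have "real (l choose r) * fact r / real l ^ r \<le> ?f (m * l)" if "1 \<le> m" for m
  proof -
    have pos: "0 < real (m * l choose r)" "0 < real l ^ r"
      using assms that by (simp_all add: order_trans[of r l "m * l"])
    have "(m * l choose r) * fact r \<le> (m * l) ^ r"
      by (rule binomial_fact_pow)
    then have "(l choose r) * ((m * l choose r) * fact r) \<le> (l choose r) * (m * l) ^ r"
      by (rule mult_le_mono2)
    also have "\<dots> = ((l choose r) * m ^ r) * l ^ r"
      by (simp add: power_mult_distrib)
    also have "\<dots> \<le> turan_ex r (m * l) ?F * l ^ r"
      by (intro mult_le_mono1 turan_ex_complete_ge assms(1))
    finally have "real ((l choose r) * ((m * l choose r) * fact r)) \<le> real (turan_ex r (m * l) ?F * l ^ r)"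
      by (rule of_nat_mono)
    then have "real (l choose r) * fact r * real (m * l choose r) \<le> real (turan_ex r (m * l) ?F) * real l ^ r"
      by (simp add: mult_ac)
    then show ?thesis
      using pos by (simp add: divide_simps mult_ac)
  qed
  then show ?thesis
    by (intro LIMSEQ_le_const[OF lim]) blast
qed

text \<open>A discrete intermediate value argument: adding the sets of \<open>E\<close> one by one
  moves the density from 0 past \<open>t\<close> in upward jumps of at most
  \<open>1 / r\<close>.\<close>

lemma turan_density_near:
  assumes "finite E" "\<And>A. A \<in> E \<Longrightarrow> card A = r" "0 < r"
    and "0 \<le> t" "t \<le> turan_density r (noncolourable r E)"
  shows "\<exists>E'. \<bar>turan_density r (noncolourable r E') - t\<bar> \<le> 1 / r"
  using assms(1,2,5)
proof (induction E rule: finite_induct)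
  case empty
  then have "t = 0"
    using assms(4) by (simp add: turan_density_empty)
  then show ?case
    by (intro exI[of _ "{}"]) (simp add: turan_density_empty)
next
  case (insert A E)
  show ?case
  proof (cases "t \<le> turan_density r (noncolourable r E)")
    case True
    then show ?thesis using insert by blast
  next
    \<comment> \<open>Here \<open>t\<close> lies within the jump caused by \<open>A\<close>, so the
      density after the jump is close enough.\<close>
    case False
    then show ?thesis
      using insert.prems turan_density_insert[of A r E] assms(3)
      by (intro exI[of _ "insert A E"]) auto
  qed
qed

theorem corollary2:
  shows "closure (\<Union>r\<in>{2..}. turan_densities r) = {0..1}"
proof
  have "(\<Union>r\<in>{2..}. turan_densities r) \<subseteq> {0..1}"
    using turan_density_in_unit by (auto simp: turan_densities_def)
  then show "closure (\<Union>r\<in>{2..}. turan_densities r) \<subseteq> {0..1}"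
    by (rule closure_minimal) simp
next
  show "{0..1} \<subseteq> closure (\<Union>r\<in>{2..}. turan_densities r)"
  proof
    fix t :: real assume t: "t \<in> {0..1}"
    show "t \<in> closure (\<Union>r\<in>{2..}. turan_densities r)"
      unfolding closure_approachable
    proof (intro allI impI)
      fix \<epsilon> :: real assume \<epsilon>: "0 < \<epsilon>"
      obtain k where k: "inverse (real (Suc k)) < \<epsilon>"
        using reals_Archimedean[OF \<epsilon>] by blast
      \<comment> \<open>The extra successor ensures \<open>2 \<le> r\<close>.\<close>
      define r where "r = Suc (Suc k)"
      have "1 / real r \<le> inverse (real (Suc k))"
        by (simp add: r_def field_simps)
      with k have r: "2 \<le> r" "1 / real r < \<epsilon>"
        by (simp_all add: r_def)
      have "eventually (\<lambda>l. 1 - \<epsilon> < real (l choose r) * fact r / real l ^ r) sequentially"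
        using order_tendstoD(1)[OF tendsto_binomial_over_power] \<epsilon> by simp
      with eventually_ge_at_top[of r]
      have "eventually (\<lambda>l. r \<le> l \<and> 1 - \<epsilon> < real (l choose r) * fact r / real l ^ r) sequentially"
        by eventually_elim simp
      then obtain l where l: "r \<le> l" "1 - \<epsilon> < real (l choose r) * fact r / real l ^ r"
        by (auto simp: eventually_sequentially)
      let ?K = "nsets {..<l} r"
      have K: "1 - \<epsilon> < turan_density r (noncolourable r ?K)"
        using turan_density_complete_ge[of l r] l r(1) by simp
      have "\<exists>E. \<bar>turan_density r (noncolourable r E) - t\<bar> < \<epsilon>"
      proof (cases "t \<le> turan_density r (noncolourable r ?K)")
        case True
        have "\<exists>E. \<bar>turan_density r (noncolourable r E) - t\<bar> \<le> 1 / r"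
          using True t r(1)
          by (intro turan_density_near[of ?K]) (auto simp: nsets_def finite_imp_finite_nsets)
        then show ?thesis
          using r(2) by (meson le_less_trans)
      next
        \<comment> \<open>Now the density for \<open>?K\<close> and \<open>t\<close> both lie above
          \<open>1 - \<epsilon>\<close> and at most at 1, so \<open>?K\<close> itself
          serves.\<close>
        case False
        then show ?thesis
          using K t by (intro exI[of _ ?K]) auto
      qed
      then obtain E where "\<bar>turan_density r (noncolourable r E) - t\<bar> < \<epsilon>" ..
      moreover have "turan_density r (noncolourable r E) \<in> turan_densities r"
        unfolding turan_densities_def using forbidden_family_noncolourable by blast
      ultimately show "\<exists>y\<in>\<Union>r\<in>{2..}. turan_densities r. dist y t < \<epsilon>"
        using r(1) by (force simp: dist_real_def)
    qed
  qed
qed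

end
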